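(* Let $\phi$ be the function $$\phi(s)=\frac{\prod_{j=1}^{m}\Gamma^{B_j}(b_j-\beta_j s)\,\prod_{j=1}^{n}\Gamma^{A_j}(1-a_j+\alpha_j s)}{\prod_{j=m+1}^{q}\Gamma^{B_j}(1-b_j+\beta_j s)\,\prod_{j=n+1}^{p}\Gamma^{A_j}(a_j-\alpha_j s)}$$ with parameters as described in the context. Let $L$ be a contour going from $\sigma-i\infty$ to $\sigma+i\infty$ ($\sigma$ real) such that all the singularities of $\Gamma^{B_j}(b_j-\beta_j s)$, $j=1,\ldots,m$, lie to the right of $L$, and all the singularities of $\Gamma^{A_j}(1-a_j+\alpha_j s)$, $j=1,\ldots,n$, lie to the left of $L$. Put $$\Delta=\sum_{j=1}^{m}B_j\beta_j-\sum_{j=m+1}^{q}B_j\beta_j+\sum_{j=1}^{n}A_j\alpha_j-\sum_{j=n+1}^{p}A_j\alpha_j,$$ $$\mu=\sum_{j=1}^{q}B_j\beta_j-\sum_{j=1}^{p}A_j\alpha_j,$$ $$\nabla=\sum_{j=1}^{p}A_j\left[\operatorname{Re}(a_j)-\tfrac12\right]-\sum_{j=1}^{q}B_j\left[\operatorname{Re}(b_j)-\tfrac12\right].$$ Let $z\neq 0$. Then the integral $$\frac{1}{2\pi i}\int_L \phi(s)\,z^s\,ds$$ converges when $|\arg z|<\Delta\pi/2$, if $\Delta>0$. If $|\arg z|=\Delta\pi/2$ and $\Delta\ge 0$, the integral converges absolutely in each of the following cases: (i) $\mu=0$ and $\nabla>1$; (ii) $\mu\neq 0$ and, writing $s=\sigma+it$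 with $\sigma$ and $t$ real for the points of $L$, $\sigma$ is chosen so that for $|t|\to\infty$ one has $\nabla+\sigma\mu>1$.
   Context: The integral in question defines the $I$-function $I^{m\,n}_{p\,q}\left[z\,\middle|\,\begin{matrix}(a_1,\alpha_1,A_1),\ldots,(a_p,\alpha_p,A_p)\\(b_1,\beta_1,B_1),\ldots,(b_q,\beta_q,B_q)\end{matrix}\right]=(2\pi i)^{-1}\int_L\phi(s)z^s\,ds$, a generalization of Fox's $H$-function. Standing assumptions: $z\ne 0$ is complex; $i=\sqrt{-1}$; $m,n,p,q$ are integers with $0\le m\le q$ and $0\le n\le p$; an empty product is interpreted as $1$ (and an empty sum as $0$); $\alpha_j,A_j$ ($j=1,\ldots,p$) and $\beta_j,B_j$ ($j=1,\ldots,q$) are positive real numbers, not necessarily integers; $a_j$ ($j=1,\ldots,p$) and $b_j$ ($j=1,\ldots,q$) are complex numbers such that no singularity of $\Gamma^{B_j}(b_j-\beta_j s)$, $j=1,\ldots,m$, coincides with any singularity of $\Gamma^{A_j}(1-a_j+\alpha_j s)$, $j=1,\ldots,n$. Here $\Gamma^{B}(w)$ denotes the power $(\Gamma(w))^{B}$. When the exponent is not an integer, the poles of the gamma functions in the numerator become branch points; the branch cuts are chosen so that the path of integration $L$ does not meet them, so that $\phi$ is given by a continuous branch along $L$. The power $z^s$ means $\exp\{s(\ln|z|+i\arg z)\}$. *)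

theory Defs
  imports "HOL-Analysis.Analysis"
begin

text \<open>
  A contour from \<open>\<sigma> - \<i>\<infinity>\<close> to \<open>\<sigma> + \<i>\<infinity>\<close>, as a parametrised simple curve
  \<open>\<gamma>\<close> on the real line.  \<open>at_infinity\<close> covers both ends \<open>t \<rightarrow> \<plusminus>\<infinity>\<close>.
  The Lipschitz condition (say, arc length parametrisation of the bounded part) keeps the
  curve locally rectifiable, which \<open>piecewise_C1_differentiable_on\<close> alone does not, since it
  allows an unbounded derivative near the exceptional points.  Near both ends the
  curve is parametrised by height, \<open>\<gamma> t = x t + \<i> t\<close> with \<open>x t \<rightarrow> \<sigma>\<close>, so that its length is
  controlled by its height; without that, absolute convergence along it is hopeless.  The line
  \<open>Re s = \<sigma>\<close> with any indentations in a bounded region is the basic example.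
\<close>

definition upward_contour :: "real \<Rightarrow> (real \<Rightarrow> complex) \<Rightarrow> bool" where
  "upward_contour \<sigma> \<gamma> \<longleftrightarrow>
     inj \<gamma> \<and>
     (\<exists>K. K-lipschitz_on UNIV \<gamma>) \<and>
     (\<forall>R. \<gamma> piecewise_C1_differentiable_on {-R..R}) \<and>
     (\<exists>R. \<forall>t. \<bar>t\<bar> \<ge> R \<longrightarrow> Im (\<gamma> t) = t) \<and>
     ((\<lambda>t. Re (\<gamma> t)) \<longlongrightarrow> \<sigma>) at_infinity"

text \<open>
  The sides of an upward contour: the components of its complement that contain the points far
  out on the negative, respectively positive, real axis.
\<close>

definition left_of :: "(real \<Rightarrow> complex) \<Rightarrow> complex set" where
  "left_of \<gamma> =
     {w. \<forall>\<^sub>F x in at_bot. connected_component (- range \<gamma>) w (complex_of_real x)}"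

definition right_of :: "(real \<Rightarrow> complex) \<Rightarrow> complex set" where
  "right_of \<gamma> =
     {w. \<forall>\<^sub>F x in at_top. connected_component (- range \<gamma>) w (complex_of_real x)}"

text \<open>
  For \<open>B > 0\<close> the singularities of \<open>\<Gamma>\<^sup>B(w s)\<close> (poles or branch points, according to whether \<open>B\<close>
  is an integer or not) are the points at which \<open>\<Gamma>(w s)\<close> has a pole.
\<close>

definition gamma_singularities :: "(complex \<Rightarrow> complex) \<Rightarrow> complex set" where
  "gamma_singularities w = {s. w s \<in> \<int>\<^sub>\<le>\<^sub>0}"

text \<open>
  \<open>g\<close> is a continuous branch of \<open>\<Gamma>\<^sup>B(w s)\<close> along \<open>L\<close>.  At a pole of \<open>\<Gamma>(w s)\<close> we use the
  convention of the library for \<open>Gamma\<close>, value \<open>0\<close>; then \<open>1 / g\<close> has there its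
  correct value \<open>0\<close> and is continuous on \<open>L\<close>.  This matters only for denominator factors,
  since numerator factors have no pole on the contour.
\<close>

definition gamma_power_branch ::
    "complex set \<Rightarrow> real \<Rightarrow> (complex \<Rightarrow> complex) \<Rightarrow> (complex \<Rightarrow> complex) \<Rightarrow> bool" where
  "gamma_power_branch L B w g \<longleftrightarrow>
     (\<exists>l. continuous_on (L - gamma_singularities w) l \<and>
          (\<forall>s \<in> L - gamma_singularities w.
             exp (l s) = Gamma (w s) \<and> g s = exp (complex_of_real B * l s))) \<and>
     (\<forall>s \<in> L \<inter> gamma_singularities w. g s = 0)"

definition I_phi_branch ::
    "complex set \<Rightarrow> nat \<Rightarrow> nat \<Rightarrow> nat \<Rightarrow> nat \<Rightarrow>
     (nat \<Rightarrow> complex) \<Rightarrow> (nat \<Rightarrow> real) \<Rightarrow> (nat \<Rightarrow> real) \<Rightarrow>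
     (nat \<Rightarrow> complex) \<Rightarrow> (nat \<Rightarrow> real) \<Rightarrow> (nat \<Rightarrow> real) \<Rightarrow> (complex \<Rightarrow> complex) \<Rightarrow> bool" where
  "I_phi_branch L m n p q a \<alpha> A b \<beta> B \<phi> \<longleftrightarrow>
     (\<exists>G H :: nat \<Rightarrow> complex \<Rightarrow> complex.
        (\<forall>j\<in>{1..m}. gamma_power_branch L (B j) (\<lambda>s. b j - \<beta> j * s) (G j)) \<and>
        (\<forall>j\<in>{1..n}. gamma_power_branch L (A j) (\<lambda>s. 1 - a j + \<alpha> j * s) (H j)) \<and>
        (\<forall>j\<in>{m+1..q}. gamma_power_branch L (B j) (\<lambda>s. 1 - b j + \<beta> j * s) (G j)) \<and>
        (\<forall>j\<in>{n+1..p}. gamma_power_branch L (A j) (\<lambda>s. a j - \<alpha> j * s) (H j)) \<and>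
        (\<forall>s\<in>L. \<phi> s = ((\<Prod>j=1..m. G j s) * (\<Prod>j=1..n. H j s)) /
                      ((\<Prod>j=m+1..q. G j s) * (\<Prod>j=n+1..p. H j s))))"

definition I_Delta ::
    "nat \<Rightarrow> nat \<Rightarrow> nat \<Rightarrow> nat \<Rightarrow> (nat \<Rightarrow> real) \<Rightarrow> (nat \<Rightarrow> real) \<Rightarrow>
     (nat \<Rightarrow> real) \<Rightarrow> (nat \<Rightarrow> real) \<Rightarrow> real" where
  "I_Delta m n p q \<alpha> A \<beta> B =
     (\<Sum>j=1..m. B j * \<beta> j) - (\<Sum>j=m+1..q. B j * \<beta> j) +
     (\<Sum>j=1..n. A j * \<alpha> j) - (\<Sum>j=n+1..p. A j * \<alpha> j)"

definition I_mu ::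
    "nat \<Rightarrow> nat \<Rightarrow> (nat \<Rightarrow> real) \<Rightarrow> (nat \<Rightarrow> real) \<Rightarrow>
     (nat \<Rightarrow> real) \<Rightarrow> (nat \<Rightarrow> real) \<Rightarrow> real" where
  "I_mu p q \<alpha> A \<beta> B = (\<Sum>j=1..q. B j * \<beta> j) - (\<Sum>j=1..p. A j * \<alpha> j)"

definition I_nabla ::
    "nat \<Rightarrow> nat \<Rightarrow> (nat \<Rightarrow> complex) \<Rightarrow> (nat \<Rightarrow> real) \<Rightarrow>
     (nat \<Rightarrow> complex) \<Rightarrow> (nat \<Rightarrow> real) \<Rightarrow> real" where
  "I_nabla p q a A b B =
     (\<Sum>j=1..p. A j * (Re (a j) - 1/2)) - (\<Sum>j=1..q. B j * (Re (b j) - 1/2))"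

text \<open>
  Here \<open>\<theta>\<close> is the chosen value of \<open>arg z\<close>, not necessarily the principal one.
\<close>

definition power_arg :: "complex \<Rightarrow> real \<Rightarrow> complex \<Rightarrow> complex" where
  "power_arg z \<theta> s = exp (s * (complex_of_real (ln (cmod z)) + \<i> * complex_of_real \<theta>))"

text \<open>
  Convergence of the integral of \<open>f\<close> along \<open>\<gamma>\<close>.  The gauge integral over the whole line is
  by definition (see \<open>has_integral_alt\<close>) the limit of the integrals over \<open>{c..d}\<close>
  as \<open>c \<rightarrow> -\<infinity>\<close> and \<open>d \<rightarrow> \<infinity>\<close> independently, so plain integrability on \<open>UNIV\<close> is convergence
  of the (possibly only conditionally convergent) improper integral.  The derivative may fail to
  exist at finitely many points of each bounded interval, which does not affect the integral.
\<close>

definition contour_integral_converges ::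
    "(complex \<Rightarrow> complex) \<Rightarrow> (real \<Rightarrow> complex) \<Rightarrow> bool" where
  "contour_integral_converges f \<gamma> \<longleftrightarrow>
     (\<lambda>t. f (\<gamma> t) * vector_derivative \<gamma> (at t)) integrable_on UNIV"

definition contour_integral_converges_absolutely ::
    "(complex \<Rightarrow> complex) \<Rightarrow> (real \<Rightarrow> complex) \<Rightarrow> bool" where
  "contour_integral_converges_absolutely f \<gamma> \<longleftrightarrow>
     (\<lambda>t. f (\<gamma> t) * vector_derivative \<gamma> (at t)) absolutely_integrable_on UNIV"

end

theory Submission
  imports Defs "HOL-Library.Landau_Symbols"
begin

text \<open>
  Along the contour, \<open>|\<Gamma>\<^sup>B(w)| = |\<Gamma>(w)| powr B\<close> whatever the branch, and Stirling's estimate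
  \<open>ln |\<Gamma>(x + \<i>y)| = (x - 1/2) ln |y| - \<pi>|y|/2 + O(1)\<close>, uniform for bounded \<open>x\<close>, gives
  \<open>ln |\<phi>(s)| = - (\<nabla> + \<mu> Re s) ln |t| - \<pi>\<Delta>|t|/2 + O(1)\<close> with \<open>t = Im s\<close>.  Since
  \<open>ln |z\<^sup>s| = - \<theta>t + O(1)\<close>, the integrand decays exponentially if \<open>|\<theta>| < \<pi>\<Delta>/2\<close>, and like
  \<open>|t|\<close> to the power \<open>- (\<nabla> + \<mu>\<sigma>)\<close> up to \<open>|t|\<^sup>\<epsilon>\<close> on the boundary.  On bounded parts it is a
  continuous function times the bounded derivative of the contour.
\<close>

subsection \<open>The modulus of the Gamma function on vertical strips\<close>

text \<open>\<open>Polygamma 1 z\<close> is the series of \<open>1 / (z + k)^2\<close>, which has a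
  majorant free of \<open>z\<close>: for \<open>k <= M\<close> the imaginary part keeps each term at
  most 1, and for larger \<open>k\<close> the real part of \<open>z + k\<close> is at least
  \<open>k - M\<close>. This controls the second derivative of \<open>ln |Gamma|\<close> along
  horizontal segments.\<close>

lemma norm_Polygamma_1_le:
  obtains C where "C \<ge> 0"
    "\<And>z::complex. \<bar>Re z\<bar> \<le> real M \<Longrightarrow> \<bar>Im z\<bar> \<ge> 1 \<Longrightarrow> cmod (Polygamma 1 z) \<le> C"
proof
  define g where "g k = (if k < Suc M then 1 else inverse (real (k - M) ^ 2))" for k
  have "summable (\<lambda>k. g (k + Suc M))"
    using summable_ignore_initial_segment[OF inverse_power_summable[of 2, where 'a = real], of 1]
    by (simp add: g_def Suc_diff_le)
  then have g: "summable g"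
    by (rule summable_iff_shift[THEN iffD1])
  show "suminf g \<ge> 0"
    by (intro suminf_nonneg g) (auto simp: g_def)
  fix z :: complex
  assume z: "\<bar>Re z\<bar> \<le> real M" "\<bar>Im z\<bar> \<ge> 1"
  have "cmod (\<Sum>k. inverse ((z + of_nat k) ^ 2)) \<le> suminf g"
  proof (rule norm_suminf_le[OF _ g])
    fix k
    show "cmod (inverse ((z + of_nat k) ^ 2)) \<le> g k"
    proof (cases "k < Suc M")
      case True
      have "1 \<le> cmod (z + of_nat k)"
        using abs_Im_le_cmod[of "z + of_nat k"] z by simp
      then show ?thesis
        using True by (simp add: g_def norm_inverse norm_power inverse_le_1_iff)
    next
      case False
      have "real (k - M) \<le> cmod (z + of_nat k)"
        using abs_Re_le_cmod[of "z + of_nat k"] z False by (simp add: of_nat_diff)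
      then show ?thesis
        using False by (simp add: g_def norm_inverse norm_power le_imp_inverse_le power_mono)
    qed
  qed
  then show "cmod (Polygamma 1 z) \<le> suminf g"
    by (simp add: Polygamma_def numeral_2_eq_2)
qed

text \<open>On the line of real part 1/2, \<open>1 - z\<close> is the conjugate of \<open>z\<close>,
  so the product in Euler's reflection formula is a squared modulus, while \<open>sin (pi z)\<close>
  becomes \<open>cosh (pi y)\<close>.\<close>

lemma cmod_Gamma_half_vertical:
  "cmod (Gamma (Complex (1/2) y)) ^ 2 = pi / cosh (pi * y)"
proof -
  let ?z = "Complex (1/2) y"
  have 1: "1 - ?z = cnj ?z"
    by (simp add: complex_eq_iff)
  have "sin (of_real pi * ?z) = cos (\<i> * of_real (pi * y))"
  proof -
    have "of_real pi * ?z = of_real pi / 2 + \<i> * of_real (pi * y)"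
      by (simp add: complex_eq_iff)
    then show ?thesis
      by (simp add: sin_cos_eq)
  qed
  also have "\<dots> = of_real (cosh (pi * y))"
    by (simp add: cos_i_times cosh_def exp_of_real exp_minus del: of_real_mult)
  finally have s: "sin (of_real pi * ?z) = of_real (cosh (pi * y))" .
  have "of_real (cmod (Gamma ?z) ^ 2) = Gamma ?z * Gamma (1 - ?z)"
    unfolding 1 complex_norm_square cnj_Gamma ..
  also have "\<dots> = of_real (pi / cosh (pi * y))"
    by (simp add: Gamma_reflection_complex s)
  finally show ?thesis
    by (simp only: of_real_eq_iff)
qed

lemma abs_ln_cosh_minus_abs_le:
  fixes x :: real
  shows "\<bar>ln (cosh x) - \<bar>x\<bar>\<bar> \<le> ln 2"
proof -
  have *: "cosh x = cosh \<bar>x\<bar>"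
    by (simp add: abs_if)
  have "exp \<bar>x\<bar> / 2 \<le> cosh x" "cosh x \<le> exp \<bar>x\<bar>"
    unfolding * by (auto simp: cosh_def)
  then have "ln (exp \<bar>x\<bar> / 2) \<le> ln (cosh x)" "ln (cosh x) \<le> ln (exp \<bar>x\<bar>)"
    by (subst ln_le_cancel_iff; simp add: cosh_real_pos)+
  then show ?thesis
    by (simp add: ln_div)
qed

text \<open>A horizontal line has velocity 1, so the chain rule leaves the complex derivative
  unchanged. This makes complex derivatives available to real mean value arguments in
  \<open>x\<close>.\<close>

lemma has_real_derivative_Re_horizontal:
  assumes "(f has_field_derivative D) (at (Complex x y))"
  shows "((\<lambda>x. Re (f (Complex x y))) has_real_derivative Re D) (at x)"
proof -
  have "((\<lambda>x. Complex x y) has_vector_derivative 1) (at x)"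
    unfolding Complex_eq by (auto intro!: derivative_eq_intros)
  from field_vector_diff_chain_at[OF this assms]
  have "((\<lambda>x. f (Complex x y)) has_vector_derivative D) (at x)"
    by (simp add: o_def)
  from bounded_linear.has_vector_derivative[OF bounded_linear_Re this] show ?thesis
    by (simp add: has_real_derivative_iff_has_vector_derivative)
qed

lemma DERIV_abs_diff_le:
  fixes f f' :: "real \<Rightarrow> real"
  assumes "\<And>u. \<bar>u\<bar> \<le> M \<Longrightarrow> (f has_real_derivative f' u) (at u)"
    and "\<And>u. \<bar>u\<bar> \<le> M \<Longrightarrow> \<bar>f' u\<bar> \<le> C" and "\<bar>x\<bar> \<le> M" "\<bar>y\<bar> \<le> M"
  shows "\<bar>f x - f y\<bar> \<le> C * (2 * M)"
proof -
  have C: "C \<ge> 0"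
    using assms(2,3) by (meson abs_ge_zero order_trans)
  have "norm (f x - f y) \<le> C * norm (x - y)"
  proof (rule field_differentiable_bound[of "{-M..M}" f f' C])
    fix u assume "u \<in> {-M..M}"
    then have "\<bar>u\<bar> \<le> M"
      by auto
    then show "(f has_field_derivative f' u) (at u within {-M..M})" "norm (f' u) \<le> C"
      using assms by (auto intro: has_field_derivative_at_within)
  qed (use assms(3,4) in auto)
  also have "\<dots> \<le> C * (2 * M)"
    using C assms(3,4) by (intro mult_left_mono) auto
  finally show ?thesis
    by simp
qed

text \<open>
  Stirling's formula up to a bounded factor.  On a horizontal segment \<open>ln |\<Gamma>|\<close> has second
  derivative \<open>Re \<psi>'\<close>, which is bounded; the functional equation between \<open>1/2 + \<i>y\<close> and
  \<open>3/2 + \<i>y\<close> shows that its first derivative is \<open>ln |y| + O(1)\<close>, and the reflection formula gives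
  the value at \<open>1/2 + \<i>y\<close>.
\<close>

lemma ln_cmod_Gamma_vertical:
  fixes X :: real
  obtains C where "\<And>x y. \<bar>x\<bar> \<le> X \<Longrightarrow> \<bar>y\<bar> \<ge> 1 \<Longrightarrow>
    \<bar>ln (cmod (Gamma (Complex x y))) - ((x - 1/2) * ln \<bar>y\<bar> - pi / 2 * \<bar>y\<bar>)\<bar> \<le> C"
proof -
  \<comment> \<open>A bound of at least 2 keeps 1/2, 3/2 and the mean value point between them in
    the segment on which the derivative bounds hold.\<close>
  obtain M where M: "max X 2 \<le> real M"
    using real_arch_simple by blast
  obtain C where C: "C \<ge> 0"
    "\<And>z::complex. \<bar>Re z\<bar> \<le> real M \<Longrightarrow> \<bar>Im z\<bar> \<ge> 1 \<Longrightarrow> cmod (Polygamma 1 z) \<le> C"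
    using norm_Polygamma_1_le[of M] by blast
  \<comment> \<open>A bound for the distance of \<open>h' u\<close> from \<open>ln |y|\<close>: the
    oscillation of \<open>h'\<close> over the segment, plus the error 1 at the mean value point
    \<open>v\<close>.\<close>
  define K where "K = C * (2 * real M) + 1"
  have K: "\<bar>ln (cmod (Gamma (Complex x y))) - ((x - 1/2) * ln \<bar>y\<bar> - pi / 2 * \<bar>y\<bar>)\<bar>
              \<le> K * (2 * real M) + ln pi + ln 2"
    if x: "\<bar>x\<bar> \<le> X" and y: "\<bar>y\<bar> \<ge> 1" for x y
  proof -
    have ni: "Complex u y \<notin> \<real>\<^sub>\<le>\<^sub>0" "Complex u y \<notin> \<int>\<^sub>\<le>\<^sub>0" for u
      using y by (auto simp: complex_nonpos_Reals_iff elim!: nonpos_Ints_cases dest: arg_cong[of _ _ Im])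
    define h h' where "h u = Re (ln_Gamma (Complex u y))" and "h' u = Re (Digamma (Complex u y))" for u
    have h: "ln (cmod (Gamma (Complex u y))) = h u" for u
      using ni[of u] by (simp add: Gamma_complex_altdef h_def)
    have dh: "(h has_real_derivative h' u) (at u)" for u
      unfolding h_def h'_def
      by (intro has_real_derivative_Re_horizontal has_field_derivative_ln_Gamma_complex ni)
    have dh': "(h' has_real_derivative Re (Polygamma 1 (Complex u y))) (at u)" for u
      unfolding h'_def One_nat_def
      by (intro has_real_derivative_Re_horizontal has_field_derivative_Polygamma ni)
    have h'_diff: "\<bar>h' u - h' v\<bar> \<le> C * (2 * real M)" if "\<bar>u\<bar> \<le> real M" "\<bar>v\<bar> \<le> real M" for u v
    proof (rule DERIV_abs_diff_le[OF dh' _ that])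
      fix w :: real assume "\<bar>w\<bar> \<le> real M"
      then show "\<bar>Re (Polygamma 1 (Complex w y))\<bar> \<le> C"
        using C(2)[of "Complex w y"] abs_Re_le_cmod[of "Polygamma 1 (Complex w y)"] y
        by simp
    qed
    \<comment> \<open>The interval has length 1, so \<open>h' v\<close> is exactly the increment of
      \<open>ln |Gamma|\<close>, which the functional equation evaluates as
      \<open>ln |1/2 + iy|\<close>.\<close>
    obtain v where v: "1/2 < v" "v < 3/2" "h (3/2) - h (1/2) = (3/2 - 1/2) * h' v"
      using MVT2[of "1/2" "3/2" h h'] dh by auto
    have "Gamma (Complex (3/2) y) = Complex (1/2) y * Gamma (Complex (1/2) y)"
      using Gamma_plus1[OF ni(2)[of "1/2"]] by (simp add: complex_eq_iff plus_complex.code one_complex.code)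
    then have "h (3/2) = ln (cmod (Complex (1/2) y)) + h (1/2)"
      using ni[of "1/2"] y
      by (simp flip: h add: norm_mult ln_mult Gamma_eq_zero_iff)
    then have v': "h' v = ln (cmod (Complex (1/2) y))"
      using v by simp
    have "\<bar>y\<bar> \<le> cmod (Complex (1/2) y)" "cmod (Complex (1/2) y) \<le> 2 * \<bar>y\<bar>"
      using abs_Im_le_cmod[of "Complex (1/2) y"] cmod_le[of "Complex (1/2) y"] y by auto
    then have "ln \<bar>y\<bar> \<le> h' v" "h' v \<le> ln (2 * \<bar>y\<bar>)"
      unfolding v' using y by (auto simp only: ln_le_cancel_iff)
    then have v'': "\<bar>h' v - ln \<bar>y\<bar>\<bar> \<le> 1"
      using y ln_2_less_1 by (auto simp: ln_mult split: if_splits)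
    \<comment> \<open>Subtracting \<open>u * ln |y|\<close> leaves a function whose derivative is at
      most \<open>K\<close> in modulus, so the errors at \<open>x\<close> and at 1/2 differ by a
      bounded amount.\<close>
    have "\<bar>(h x - x * ln \<bar>y\<bar>) - (h (1/2) - 1/2 * ln \<bar>y\<bar>)\<bar> \<le> K * (2 * real M)"
    proof (rule DERIV_abs_diff_le[where M = "real M" and f = "\<lambda>u. h u - u * ln \<bar>y\<bar>" and f' = "\<lambda>u. h' u - ln \<bar>y\<bar>"])
      show "((\<lambda>u. h u - u * ln \<bar>y\<bar>) has_real_derivative h' u - ln \<bar>y\<bar>) (at u)" for u
        by (auto intro!: derivative_eq_intros dh)
      fix u :: real assume "\<bar>u\<bar> \<le> real M"
      with h'_diff[of u v] v'' v M show "\<bar>h' u - ln \<bar>y\<bar>\<bar> \<le> K"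
        unfolding K_def by linarith
    qed (use x M in auto)
    \<comment> \<open>At real part 1/2 the coefficient of \<open>ln |y|\<close> vanishes, so
      \<open>d\<close> is the whole Stirling error there.\<close>
    moreover define d where "d = h (1/2) + pi / 2 * \<bar>y\<bar>"
    have "\<bar>d\<bar> \<le> ln pi + ln 2"
    proof -
      have "2 * h (1/2) = ln (cmod (Gamma (Complex (1/2) y)) ^ 2)"
        using ni[of "1/2"] by (simp flip: h add: ln_realpow Gamma_eq_zero_iff)
      also have "\<dots> = ln pi - ln (cosh (pi * y))"
        by (subst cmod_Gamma_half_vertical) (simp add: ln_div)
      finally have "\<bar>2 * d - ln pi\<bar> \<le> ln 2"
        using abs_ln_cosh_minus_abs_le[of "pi * y"] by (simp add: abs_mult d_def)
      moreover have "ln pi \<ge> 0" "ln 2 \<ge> (0 :: real)"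
        using pi_ge_two by auto
      ultimately show ?thesis
        by linarith
    qed
    moreover have "h x - ((x - 1/2) * ln \<bar>y\<bar> - pi / 2 * \<bar>y\<bar>) =
        ((h x - x * ln \<bar>y\<bar>) - (h (1/2) - 1/2 * ln \<bar>y\<bar>)) + d"
      by (simp add: algebra_simps d_def)
    ultimately show ?thesis
      unfolding h by linarith
  qed
  then show ?thesis
    using that by blast
qed

subsection \<open>Growth up to bounded factors\<close>

text \<open>The size of \<open>f\<close> near both ends, up to factors bounded above and away from
  0. Nonvanishing is a separate clause because \<open>ln 0 = 0\<close> by convention: the estimate
  alone would not rule out zeros, at which logarithms of products do not split.\<close>

definition log_growth :: "(real \<Rightarrow> complex) \<Rightarrow> (real \<Rightarrow> real) \<Rightarrow> bool" where
  "log_growth f E \<longleftrightarrow>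
     (\<forall>\<^sub>F t in at_infinity. f t \<noteq> 0) \<and> (\<lambda>t. ln (cmod (f t)) - E t) \<in> O[at_infinity](\<lambda>_. 1)"

lemma log_growth_mult:
  assumes "log_growth f E" "log_growth g E'"
  shows "log_growth (\<lambda>t. f t * g t) (\<lambda>t. E t + E' t)"
  unfolding log_growth_def
proof
  have nz: "\<forall>\<^sub>F t in at_infinity. f t \<noteq> 0 \<and> g t \<noteq> 0"
    using assms by (simp add: log_growth_def eventually_conj_iff)
  then show "\<forall>\<^sub>F t in at_infinity. f t * g t \<noteq> 0"
    by simp
  have "(\<lambda>t. (ln (cmod (f t)) - E t) + (ln (cmod (g t)) - E' t)) \<in> O[at_infinity](\<lambda>_. 1)"
    using assms by (intro sum_in_bigo(1)) (simp_all only: log_growth_def)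
  moreover have "\<forall>\<^sub>F t in at_infinity. ln (cmod (f t * g t)) - (E t + E' t) =
        (ln (cmod (f t)) - E t) + (ln (cmod (g t)) - E' t)"
    using nz by eventually_elim (simp add: norm_mult ln_mult)
  ultimately show "(\<lambda>t. ln (cmod (f t * g t)) - (E t + E' t)) \<in> O[at_infinity](\<lambda>_. 1)"
    by (simp only: landau_o.big.in_cong)
qed

lemma log_growth_inverse:
  assumes "log_growth f E"
  shows "log_growth (\<lambda>t. inverse (f t)) (\<lambda>t. - E t)"
proof -
  have "(\<lambda>t. ln (cmod (inverse (f t))) - - E t) = (\<lambda>t. - (ln (cmod (f t)) - E t))"
    by (auto simp: norm_inverse ln_inverse)
  then show ?thesis
    using assms by (simp only: log_growth_def landau_o.big.uminus_in_iff) simp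
qed

lemma log_growth_const: "c \<noteq> 0 \<Longrightarrow> log_growth (\<lambda>_. c) (\<lambda>_. 0)"
  by (simp add: log_growth_def)

lemma log_growth_prod:
  assumes "\<And>j. j \<in> J \<Longrightarrow> log_growth (f j) (E j)"
  shows "log_growth (\<lambda>t. \<Prod>j\<in>J. f j t) (\<lambda>t. \<Sum>j\<in>J. E j t)"
  using assms
proof (induction J rule: infinite_finite_induct)
  case (insert i J)
  then show ?case
    using log_growth_mult[of "f i" "E i" "\<lambda>t. \<Prod>j\<in>J. f j t" "\<lambda>t. \<Sum>j\<in>J. E j t"] by simp
qed (simp_all add: log_growth_const)

text \<open>With \<open>w = c + \<kappa> * \<gamma> t\<close> the error splits into three bounded
  pieces: Stirling's at \<open>w\<close>, the passage from \<open>ln |Im w|\<close> to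
  \<open>ln |t|\<close>, and the one from \<open>|Im w|\<close> to \<open>|\<kappa>| * |t|\<close>.
  The exponent keeps \<open>Re (\<gamma> t)\<close> in place of its limit, since
  \<open>(Re (\<gamma> t) - \<sigma>) * ln |t|\<close> may be unbounded.\<close>

lemma log_growth_Gamma:
  fixes \<gamma> :: "real \<Rightarrow> complex" and c :: complex and \<kappa> :: real
  assumes "\<kappa> \<noteq> 0" "\<forall>\<^sub>F t in at_infinity. Im (\<gamma> t) = t" "((\<lambda>t. Re (\<gamma> t)) \<longlongrightarrow> \<sigma>) at_infinity"
  shows "log_growth (\<lambda>t. Gamma (c + \<kappa> * \<gamma> t))
    (\<lambda>t. (Re c + \<kappa> * Re (\<gamma> t) - 1/2) * ln \<bar>t\<bar> - pi / 2 * (\<bar>\<kappa>\<bar> * \<bar>t\<bar>))"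
proof -
  define X where "X = \<bar>Re c\<bar> + \<bar>\<kappa>\<bar> * (\<bar>\<sigma>\<bar> + 1)"
  define w where "w t = c + \<kappa> * \<gamma> t" for t
  obtain C where C: "\<And>x y. \<bar>x\<bar> \<le> X \<Longrightarrow> \<bar>y\<bar> \<ge> 1 \<Longrightarrow>
    \<bar>ln (cmod (Gamma (Complex x y))) - ((x - 1/2) * ln \<bar>y\<bar> - pi / 2 * \<bar>y\<bar>)\<bar> \<le> C"
    using ln_cmod_Gamma_vertical by blast
  \<comment> \<open>Eventually \<open>|Im w|\<close> lies between \<open>|\<kappa> t| / 2\<close>
    and \<open>2 |\<kappa> t|\<close>, so \<open>ln |Im w| - ln |t|\<close> lies between
    \<open>ln (|\<kappa>| / 2)\<close> and \<open>ln (2 |\<kappa>|)\<close>.\<close>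
  define N where "N = \<bar>ln (\<bar>\<kappa>\<bar> / 2)\<bar> + \<bar>ln (2 * \<bar>\<kappa>\<bar>)\<bar>"
  have "\<forall>\<^sub>F t in at_infinity. \<bar>Re (\<gamma> t) - \<sigma>\<bar> < 1"
    using tendstoD[OF assms(3), of 1] by (simp add: dist_norm)
  \<comment> \<open>This threshold makes \<open>|\<kappa> t|\<close> exceed
    \<open>2 (|Im c| + 1)\<close>, so the shift by \<open>Im c\<close> cannot bring
    \<open>|Im w|\<close> below 1 or below half of \<open>|\<kappa> t|\<close>.\<close>
  moreover have "\<forall>\<^sub>F t :: real in at_infinity. \<bar>t\<bar> \<ge> 1 + 2 * (\<bar>Im c\<bar> + 1) / \<bar>\<kappa>\<bar>"
    unfolding eventually_at_infinity real_norm_def by blast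
  ultimately have ev: "\<forall>\<^sub>F t in at_infinity. w t \<notin> \<int>\<^sub>\<le>\<^sub>0 \<and>
      \<bar>ln (cmod (Gamma (w t))) -
        ((Re c + \<kappa> * Re (\<gamma> t) - 1/2) * ln \<bar>t\<bar> - pi / 2 * (\<bar>\<kappa>\<bar> * \<bar>t\<bar>))\<bar>
      \<le> C + (X + 1/2) * N + pi / 2 * \<bar>Im c\<bar>"
    using assms(2)
  proof eventually_elim
    case (elim t)
    have Re: "Re (w t) = Re c + \<kappa> * Re (\<gamma> t)" and Im: "Im (w t) = Im c + \<kappa> * t"
      using elim by (auto simp: w_def)
    have "\<bar>\<kappa> * Re (\<gamma> t)\<bar> \<le> \<bar>\<kappa>\<bar> * (\<bar>\<sigma>\<bar> + 1)"
      unfolding abs_mult using elim(1) by (intro mult_left_mono) auto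
    then have X: "\<bar>Re (w t)\<bar> \<le> X"
      unfolding Re X_def by linarith
    have "\<bar>\<kappa>\<bar> * \<bar>t\<bar> \<ge> \<bar>\<kappa>\<bar> * (1 + 2 * (\<bar>Im c\<bar> + 1) / \<bar>\<kappa>\<bar>)"
      using elim(2) by (intro mult_left_mono) auto
    also have "\<bar>\<kappa>\<bar> * (1 + 2 * (\<bar>Im c\<bar> + 1) / \<bar>\<kappa>\<bar>) = \<bar>\<kappa>\<bar> + 2 * (\<bar>Im c\<bar> + 1)"
      using assms(1) by (simp add: field_simps)
    finally have kt: "\<bar>\<kappa>\<bar> * \<bar>t\<bar> \<ge> \<bar>\<kappa>\<bar> + 2 * (\<bar>Im c\<bar> + 1)" .
    have Imd: "\<bar>\<bar>Im (w t)\<bar> - \<bar>\<kappa>\<bar> * \<bar>t\<bar>\<bar> \<le> \<bar>Im c\<bar>"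
      unfolding Im abs_mult[symmetric] by linarith
    have y1: "\<bar>Im (w t)\<bar> \<ge> 1" "\<bar>Im (w t)\<bar> \<ge> \<bar>\<kappa>\<bar> / 2 * \<bar>t\<bar>" "\<bar>Im (w t)\<bar> \<le> 2 * \<bar>\<kappa>\<bar> * \<bar>t\<bar>"
    proof -
      have *: "1 \<le> y \<and> u / 2 \<le> y \<and> y \<le> 2 * u"
        if "k \<ge> 0" "d \<ge> 0" "y - u \<le> d" "u - y \<le> d" "k + 2 * (d + 1) \<le> u" for k d u y :: real
        using that by auto
      show "\<bar>Im (w t)\<bar> \<ge> 1" "\<bar>Im (w t)\<bar> \<ge> \<bar>\<kappa>\<bar> / 2 * \<bar>t\<bar>" "\<bar>Im (w t)\<bar> \<le> 2 * \<bar>\<kappa>\<bar> * \<bar>t\<bar>"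
        using *[of "\<bar>\<kappa>\<bar>" "\<bar>Im c\<bar>" "\<bar>Im (w t)\<bar>" "\<bar>\<kappa>\<bar> * \<bar>t\<bar>"] Imd kt by (auto simp: abs_le_iff)
    qed
    have t: "t \<noteq> 0"
      using kt by auto
    have ln: "ln (\<bar>\<kappa>\<bar> / 2 * \<bar>t\<bar>) \<le> ln \<bar>Im (w t)\<bar>" "ln \<bar>Im (w t)\<bar> \<le> ln (2 * \<bar>\<kappa>\<bar> * \<bar>t\<bar>)"
      using y1 t assms(1) by (subst ln_le_cancel_iff; simp)+
    have N: "\<bar>ln \<bar>Im (w t)\<bar> - ln \<bar>t\<bar>\<bar> \<le> N"
    proof -
      have *: "\<bar>r - s\<bar> \<le> \<bar>p\<bar> + \<bar>q\<bar>" if "p + s \<le> r" "r \<le> q + s" for p q r s :: real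
        using that by linarith
      have **: "ln (\<bar>\<kappa>\<bar> / 2 * \<bar>t\<bar>) = ln (\<bar>\<kappa>\<bar> / 2) + ln \<bar>t\<bar>"
        "ln (2 * \<bar>\<kappa>\<bar> * \<bar>t\<bar>) = ln (2 * \<bar>\<kappa>\<bar>) + ln \<bar>t\<bar>"
        using t assms(1) by (subst ln_mult; simp)+
      show ?thesis
        unfolding N_def by (rule *) (fact ln[unfolded **])+
    qed
    have "ln (cmod (Gamma (w t))) -
        ((Re c + \<kappa> * Re (\<gamma> t) - 1/2) * ln \<bar>t\<bar> - pi / 2 * (\<bar>\<kappa>\<bar> * \<bar>t\<bar>)) =
      (ln (cmod (Gamma (w t))) - ((Re (w t) - 1/2) * ln \<bar>Im (w t)\<bar> - pi / 2 * \<bar>Im (w t)\<bar>))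
      + (Re (w t) - 1/2) * (ln \<bar>Im (w t)\<bar> - ln \<bar>t\<bar>)
      - pi / 2 * (\<bar>Im (w t)\<bar> - \<bar>\<kappa>\<bar> * \<bar>t\<bar>)"
      unfolding Re by (simp add: algebra_simps)
    also have "\<bar>\<dots>\<bar> \<le> C + (X + 1/2) * N + pi / 2 * \<bar>Im c\<bar>"
    proof (rule order.trans[OF abs_triangle_ineq4 add_mono[OF order.trans[OF abs_triangle_ineq add_mono]]])
      show "\<bar>ln (cmod (Gamma (w t))) - ((Re (w t) - 1/2) * ln \<bar>Im (w t)\<bar> - pi / 2 * \<bar>Im (w t)\<bar>)\<bar> \<le> C"
        using C[OF X y1(1)] by simp
      show "\<bar>(Re (w t) - 1/2) * (ln \<bar>Im (w t)\<bar> - ln \<bar>t\<bar>)\<bar> \<le> (X + 1/2) * N"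
        unfolding abs_mult using X N by (intro mult_mono) auto
      show "\<bar>pi / 2 * (\<bar>Im (w t)\<bar> - \<bar>\<kappa>\<bar> * \<bar>t\<bar>)\<bar> \<le> pi / 2 * \<bar>Im c\<bar>"
        unfolding abs_mult using Imd by (intro mult_mono) auto
    qed
    finally show ?case
      using y1(1) by (auto elim!: nonpos_Ints_cases)
  qed
  show ?thesis
    unfolding log_growth_def
  proof
    show "\<forall>\<^sub>F t in at_infinity. Gamma (c + \<kappa> * \<gamma> t) \<noteq> 0"
      using ev by eventually_elim (simp add: w_def Gamma_eq_zero_iff)
  qed (rule bigoI[where c = "C + (X + 1/2) * N + pi / 2 * \<bar>Im c\<bar>"],
       use ev in eventually_elim, simp add: w_def)
qed

section \<open>Modulus and continuity of branches of real powers of Gamma\<close>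

lemma cmod_gamma_power_branch:
  assumes "gamma_power_branch L B w g" "s \<in> L"
  shows "cmod (g s) = cmod (Gamma (w s)) powr B"
proof (cases "w s \<in> \<int>\<^sub>\<le>\<^sub>0")
  case True
  \<comment> \<open>At a pole both sides are 0, because \<open>Gamma\<close> has the value 0 there
    and \<open>0 powr B = 0\<close>.\<close>
  then show ?thesis
    using assms by (auto simp: gamma_power_branch_def gamma_singularities_def Gamma_eq_zero_iff)
next
  case False
  then obtain l where "exp (l s) = Gamma (w s)" "g s = exp (complex_of_real B * l s)"
    using assms by (fastforce simp: gamma_power_branch_def gamma_singularities_def)
  \<comment> \<open>\<open>|exp (B l)| = exp (B Re l) = |exp l| powr B\<close>, whichever logarithm
    \<open>l\<close> is used.\<close>
  then show ?thesis
    by (simp add: powr_def flip: \<open>exp (l s) = Gamma (w s)\<close>)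
qed

text \<open>Raising a modulus to the power \<open>B\<close> multiplies its logarithm by
  \<open>B\<close>. The affine argument \<open>c + \<kappa> * s\<close> covers all four families of
  Gamma factors.\<close>

lemma log_growth_gamma_power_branch:
  assumes "gamma_power_branch (range \<gamma>) B w g"
    and "\<And>s. w s = c + complex_of_real \<kappa> * s"
    and "\<kappa> \<noteq> 0" "\<forall>\<^sub>F t in at_infinity. Im (\<gamma> t) = t" "((\<lambda>t. Re (\<gamma> t)) \<longlongrightarrow> \<sigma>) at_infinity"
  shows "log_growth (\<lambda>t. g (\<gamma> t))
    (\<lambda>t. B * ((Re c + \<kappa> * Re (\<gamma> t) - 1/2) * ln \<bar>t\<bar> - pi / 2 * (\<bar>\<kappa>\<bar> * \<bar>t\<bar>)))"
proof -
  define E where "E = (\<lambda>t. (Re c + \<kappa> * Re (\<gamma> t) - 1/2) * ln \<bar>t\<bar> - pi / 2 * (\<bar>\<kappa>\<bar> * \<bar>t\<bar>))"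
  have lg: "log_growth (\<lambda>t. Gamma (w (\<gamma> t))) E"
    unfolding assms(2) E_def by (rule log_growth_Gamma[OF assms(3-5)])
  have n: "cmod (g (\<gamma> t)) = cmod (Gamma (w (\<gamma> t))) powr B" for t
    by (rule cmod_gamma_power_branch[OF assms(1)]) simp
  have nz: "\<forall>\<^sub>F t in at_infinity. Gamma (w (\<gamma> t)) \<noteq> 0"
    using lg by (simp add: log_growth_def)
  have "(\<lambda>t. B * (ln (cmod (Gamma (w (\<gamma> t)))) - E t)) \<in> O[at_infinity](\<lambda>_. 1)"
    by (rule landau_o.big.mult_in_1[OF bigo_const]) (use lg in \<open>simp add: log_growth_def\<close>)
  moreover have "\<forall>\<^sub>F t in at_infinity. ln (cmod (g (\<gamma> t))) - B * E t = B * (ln (cmod (Gamma (w (\<gamma> t)))) - E t)"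
    using nz by eventually_elim (simp add: n ln_powr algebra_simps)
  moreover have "\<forall>\<^sub>F t in at_infinity. g (\<gamma> t) \<noteq> 0"
    using nz
  proof eventually_elim
    case (elim t)
    then have "cmod (g (\<gamma> t)) > 0"
      by (simp add: n)
    then show ?case
      by simp
  qed
  ultimately show ?thesis
    by (simp only: log_growth_def E_def landau_o.big.in_cong simp_thms)
qed

lemma continuous_gamma_power_branch:
  fixes \<gamma> :: "real \<Rightarrow> complex"
  assumes "gamma_power_branch (range \<gamma>) B w g" "continuous_on UNIV \<gamma>"
    and "T \<inter> \<gamma> -` gamma_singularities w = {}"
  shows "continuous_on T (\<lambda>t. g (\<gamma> t))"
proof -
  obtain l where l: "continuous_on (range \<gamma> - gamma_singularities w) l"
    "\<And>s. s \<in> range \<gamma> - gamma_singularities w \<Longrightarrow> g s = exp (complex_of_real B * l s)"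
    using assms(1) by (auto simp: gamma_power_branch_def)
  have sub: "\<gamma> ` T \<subseteq> range \<gamma> - gamma_singularities w"
    using assms(3) by auto
  have "continuous_on T (\<lambda>t. exp (complex_of_real B * l (\<gamma> t)))"
    by (intro continuous_intros continuous_on_compose2[OF l(1)] continuous_on_subset[OF assms(2)] sub) auto
  then show ?thesis
    by (rule continuous_on_eq) (use l(2) sub in force)
qed

text \<open>Across a pole of \<open>\<Gamma>(w s)\<close> the continuity comes from \<open>|1 / g| = |rGamma (w s)|\<^sup>B\<close>.\<close>

lemma continuous_inverse_gamma_power_branch:
  fixes \<gamma> :: "real \<Rightarrow> complex"
  assumes "gamma_power_branch (range \<gamma>) B w g" "continuous_on UNIV \<gamma>" "continuous_on UNIV w" "B > 0"
  shows "continuous_on UNIV (\<lambda>t. inverse (g (\<gamma> t)))"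
proof -
  define T where "T = - (\<gamma> -` gamma_singularities w)"
  have cw: "continuous_on UNIV (\<lambda>t. w (\<gamma> t))"
    by (rule continuous_on_compose2[OF assms(3,2)]) auto
  have "T = - ((\<lambda>t. w (\<gamma> t)) -` \<int>\<^sub>\<le>\<^sub>0)"
    by (auto simp: T_def gamma_singularities_def)
  then have "open T"
    using continuous_closed_vimage[OF closed_nonpos_Ints, of "\<lambda>t. w (\<gamma> t)"] cw
    by (simp add: continuous_on_eq_continuous_at open_Compl)
  \<comment> \<open>At a pole this reads \<open>0 = 0\<close>, since \<open>inverse 0 = 0\<close>
    and \<open>rGamma\<close> vanishes there.\<close>
  have n: "cmod (inverse (g (\<gamma> t))) = cmod (rGamma (w (\<gamma> t))) powr B" for t
    using cmod_gamma_power_branch[OF assms(1), of "\<gamma> t"]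
    by (simp add: rGamma_inverse_Gamma norm_inverse inverse_powr)
  have cont_T: "continuous_on T (\<lambda>t. inverse (g (\<gamma> t)))"
  proof (rule continuous_on_inverse)
    show "continuous_on T (\<lambda>t. g (\<gamma> t))"
      by (rule continuous_gamma_power_branch[OF assms(1,2)]) (auto simp: T_def)
    show "\<forall>t\<in>T. g (\<gamma> t) \<noteq> 0"
    proof
      fix t assume "t \<in> T"
      then have "cmod (g (\<gamma> t)) > 0"
        using cmod_gamma_power_branch[OF assms(1), of "\<gamma> t"]
        by (simp add: T_def gamma_singularities_def Gamma_eq_zero_iff)
      then show "g (\<gamma> t) \<noteq> 0"
        by simp
    qed
  qed
  have "isCont (\<lambda>t. inverse (g (\<gamma> t))) t" for t
  proof (cases "t \<in> T")
    case True
    then show ?thesis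
      using cont_T \<open>open T\<close> by (simp add: continuous_on_eq_continuous_at)
  next
    case False
    then have 0: "rGamma (w (\<gamma> t)) = 0"
      by (auto simp: T_def gamma_singularities_def rGamma_eq_zero_iff)
    have "isCont (\<lambda>t. w (\<gamma> t)) t"
      using cw by (simp add: continuous_on_eq_continuous_at)
    then have "isCont (\<lambda>t. cmod (rGamma (w (\<gamma> t)))) t"
      by (intro continuous_intros) auto
    then have "((\<lambda>t. cmod (rGamma (w (\<gamma> t)))) \<longlongrightarrow> 0) (at t)"
      using 0 by (simp add: isCont_def)
    \<comment> \<open>Positivity of \<open>B\<close> makes \<open>x powr B\<close> tend to 0 with
      \<open>x\<close>.\<close>
    then have "((\<lambda>t. cmod (rGamma (w (\<gamma> t))) powr B) \<longlongrightarrow> 0 powr B) (at t)"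
      using assms(4) by (intro tendsto_powr') auto
    then have "((\<lambda>t. inverse (g (\<gamma> t))) \<longlongrightarrow> 0) (at t)"
      by (simp add: n[symmetric] tendsto_norm_zero_iff)
    moreover have "inverse (g (\<gamma> t)) = 0"
      using n[of t] 0 by simp
    ultimately show ?thesis
      by (simp add: isCont_def)
  qed
  then show ?thesis
    by (simp add: continuous_on_eq_continuous_at)
qed

subsection \<open>Integration along Lipschitz curves\<close>

text \<open>Writing the derivative as the limit of a sequence of difference quotients, with steps
  \<open>1 / (n + 1)\<close>, lets measurability and bounds pass to it.\<close>

lemma has_vector_derivative_imp_LIMSEQ:
  fixes f :: "real \<Rightarrow> 'a::real_normed_vector"
  assumes "(f has_vector_derivative D) (at x)"
  shows "(\<lambda>n. real (Suc n) *\<^sub>R (f (x + 1 / real (Suc n)) - f x)) \<longlonglongrightarrow> D"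
proof -
  have "(\<lambda>h. norm (f (x + h) - f x - h *\<^sub>R D) / norm h) \<midarrow>0\<rightarrow> 0"
    using assms by (simp add: has_vector_derivative_def has_derivative_at)
  moreover have "filterlim (\<lambda>n. 1 / real (Suc n)) (at 0) sequentially"
    unfolding filterlim_at using LIMSEQ_Suc[OF lim_1_over_n[where 'a = real]] by simp
  ultimately have "(\<lambda>n. norm (f (x + 1 / real (Suc n)) - f x - (1 / real (Suc n)) *\<^sub>R D) / norm (1 / real (Suc n)))
      \<longlonglongrightarrow> 0"
    by (rule filterlim_compose)
  also have "(\<lambda>n. norm (f (x + 1 / real (Suc n)) - f x - (1 / real (Suc n)) *\<^sub>R D) / norm (1 / real (Suc n))) =
      (\<lambda>n. norm (real (Suc n) *\<^sub>R (f (x + 1 / real (Suc n)) - f x) - D))"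
  proof
    fix n
    have "real (Suc n) *\<^sub>R (f (x + 1 / real (Suc n)) - f x) - D =
        real (Suc n) *\<^sub>R (f (x + 1 / real (Suc n)) - f x - (1 / real (Suc n)) *\<^sub>R D)"
      by (simp add: scaleR_diff_right)
    then show "norm (f (x + 1 / real (Suc n)) - f x - (1 / real (Suc n)) *\<^sub>R D) / norm (1 / real (Suc n)) =
        norm (real (Suc n) *\<^sub>R (f (x + 1 / real (Suc n)) - f x) - D)"
      by simp
  qed
  finally show ?thesis
    by (simp add: tendsto_norm_zero_iff LIM_zero_cancel)
qed

text \<open>The difference quotients are Borel measurable and bounded by the Lipschitz constant, and
  both properties survive pointwise limits. The value 0 on \<open>S\<close> replaces
  \<open>vector_derivative\<close>, about which nothing is known where \<open>\<gamma>\<close> is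
  not differentiable.\<close>

lemma vector_derivative_measurable_bounded:
  fixes \<gamma> :: "real \<Rightarrow> complex"
  assumes "K-lipschitz_on UNIV \<gamma>" "countable S"
    and "\<And>t. t \<notin> S \<Longrightarrow> \<gamma> differentiable (at t)"
  defines "D \<equiv> \<lambda>t. if t \<in> S then 0 else vector_derivative \<gamma> (at t)"
  shows "D \<in> borel_measurable borel" "cmod (D t) \<le> K"
proof -
  define q where "q n t = (if t \<in> S then 0 else real (Suc n) *\<^sub>R (\<gamma> (t + 1 / real (Suc n)) - \<gamma> t))" for n t
  have q: "(\<lambda>n. q n t) \<longlonglongrightarrow> D t" for t
    using has_vector_derivative_imp_LIMSEQ assms(3)[of t]
    by (auto simp: q_def D_def vector_derivative_works)
  have [measurable]: "S \<in> sets borel"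
    by (rule sets.countable[OF _ assms(2)]) simp
  have "continuous_on UNIV \<gamma>"
    using assms(1) by (rule lipschitz_on_continuous_on)
  then have [measurable]: "\<gamma> \<in> borel_measurable borel"
    by (rule borel_measurable_continuous_onI)
  show "D \<in> borel_measurable borel"
    by (rule borel_measurable_LIMSEQ_metric[OF _ q]) (unfold q_def, measurable)
  have "K \<ge> 0"
    using assms(1) by (rule lipschitz_on_nonneg)
  have "cmod (q n t) \<le> K" for n
  proof -
    have "cmod (\<gamma> (t + 1 / real (Suc n)) - \<gamma> t) \<le> K * (1 / real (Suc n))"
      using lipschitz_onD[OF assms(1), of "t + 1 / real (Suc n)" t] by (simp add: dist_norm)
    then have "real (Suc n) * cmod (\<gamma> (t + 1 / real (Suc n)) - \<gamma> t) \<le> real (Suc n) * (K * (1 / real (Suc n)))"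
      by (intro mult_left_mono) auto
    then show ?thesis
      using \<open>K \<ge> 0\<close> by (simp add: q_def del: of_nat_Suc)
  qed
  then show "cmod (D t) \<le> K"
    using Lim_norm_ubound[OF _ q] by auto
qed

text \<open>The majorant is a constant on a compact interval plus the two tails of
  \<open>|t| powr e\<close>, integrable because \<open>e < -1\<close>.\<close>

lemma continuous_powr_decay_bound:
  fixes F :: "real \<Rightarrow> complex"
  assumes "continuous_on UNIV F" "e < -1"
    and "\<forall>\<^sub>F t in at_infinity. cmod (F t) \<le> \<bar>t\<bar> powr e"
  obtains g where "g integrable_on UNIV" "\<And>t. cmod (F t) \<le> g t"
proof -
  obtain R where R: "\<And>t. \<bar>t\<bar> \<ge> R \<Longrightarrow> cmod (F t) \<le> \<bar>t\<bar> powr e"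
    using assms(3) by (auto simp: eventually_at_infinity)
  \<comment> \<open>At least 1, so that every \<open>t\<close> with \<open>|t| > R'\<close> lies
    where \<open>k\<close> or \<open>l\<close> equals \<open>|t| powr e\<close>.\<close>
  define R' where "R' = max R 1"
  have "compact (F ` {-R'..R'})"
    by (intro compact_continuous_image continuous_on_subset[OF assms(1)]) auto
  then obtain M where M: "\<And>t. t \<in> {-R'..R'} \<Longrightarrow> cmod (F t) \<le> M"
    by (meson compact_imp_bounded bounded_iff imageI)
  have M0: "M \<ge> 0"
    using order.trans[OF norm_ge_zero M[of 0]] by (simp add: R'_def)
  define k where "k t = (if t \<in> {1..} then t powr e else 0)" for t :: real
  define l where "l t = (if t \<in> {..-1} then (-t) powr e else 0)" for t :: real
  define c where "c t = (if t \<in> {-R'..R'} then M else 0)" for t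
  have p: "(\<lambda>x. x powr e) integrable_on {1..}"
    using has_integral_powr_to_inf[OF assms(2), of 1] by (auto simp: integrable_on_def)
  then have "(\<lambda>x. x powr e) absolutely_integrable_on {1..}"
    by (rule nonnegative_absolutely_integrable_1) auto
  then have "(\<lambda>x. (-x) powr e) absolutely_integrable_on {..-1}"
    using has_absolute_integral_reflect_real[of "{..-1}" "{1..}" "\<lambda>x. x powr e"] by auto
  then have "l integrable_on UNIV"
    unfolding l_def by (subst integrable_restrict_UNIV) (rule set_lebesgue_integral_eq_integral)
  moreover have "k integrable_on UNIV"
    unfolding k_def using p by (subst integrable_restrict_UNIV)
  moreover have "c integrable_on UNIV"
    unfolding c_def by (subst integrable_restrict_UNIV) (rule integrable_const_ivl)
  ultimately have "(\<lambda>t. c t + (k t + l t)) integrable_on UNIV"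
    by (intro integrable_add)
  moreover have "cmod (F t) \<le> c t + (k t + l t)" for t
  proof (cases "\<bar>t\<bar> \<le> R'")
    case True
    then show ?thesis
      using M[of t] by (auto simp: c_def k_def l_def abs_le_iff intro: add_increasing2)
  next
    case False
    then show ?thesis
      using R[of t] M0 by (auto simp: c_def k_def l_def R'_def)
  qed
  ultimately show ?thesis
    using that by blast
qed

text \<open>\<open>F\<close> is dominated by an integrable function and the derivative by
  \<open>K\<close> outside a countable, hence negligible, set.\<close>

lemma absolutely_integrable_along_curve:
  fixes \<gamma> :: "real \<Rightarrow> complex"
  assumes "K-lipschitz_on UNIV \<gamma>" "countable S"
    and "\<And>t. t \<notin> S \<Longrightarrow> \<gamma> differentiable (at t)"
    and F: "continuous_on UNIV F" "e < -1"
      "\<forall>\<^sub>F t in at_infinity. cmod (F t) \<le> \<bar>t\<bar> powr e"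
  shows "(\<lambda>t. F t * vector_derivative \<gamma> (at t)) absolutely_integrable_on UNIV"
proof -
  define D where "D = (\<lambda>t. if t \<in> S then 0 else vector_derivative \<gamma> (at t))"
  have D: "D \<in> borel_measurable borel" "cmod (D t) \<le> K" for t
    using vector_derivative_measurable_bounded[OF assms(1-3)] by (auto simp: D_def)
  obtain g where g: "g integrable_on UNIV" "\<And>t. cmod (F t) \<le> g t"
    using continuous_powr_decay_bound[OF F] by blast
  have [measurable]: "F \<in> borel_measurable borel" "D \<in> borel_measurable borel"
    using F(1) D(1) by (auto intro: borel_measurable_continuous_onI)
  have "(\<lambda>t. F t * D t) \<in> borel_measurable lborel"
    by measurable
  then have "(\<lambda>t. F t * D t) \<in> borel_measurable (lebesgue_on UNIV)"
    by (simp add: measurable_completion lebesgue_on_UNIV_eq)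
  moreover have "(\<lambda>t. g t * K) integrable_on UNIV"
    using g(1) by (rule integrable_on_mult_left)
  moreover have "norm (F t * D t) \<le> g t * K" for t
    unfolding norm_mult using g(2)[of t] D(2)[of t]
    by (intro mult_mono) (auto intro: order_trans[OF norm_ge_zero])
  ultimately have "(\<lambda>t. F t * D t) absolutely_integrable_on UNIV"
    by (intro measurable_bounded_by_integrable_imp_absolutely_integrable) auto
  moreover have "negligible S"
    using assms(2) by (simp add: negligible_iff_null_sets countable_imp_null_set_lborel null_sets_completionI)
  ultimately show ?thesis
    by (rule absolutely_integrable_spike) (simp add: D_def)
qed

text \<open>Each interval \<open>{-n..n}\<close> has finitely many exceptional points, and these
  intervals exhaust the line.\<close>

lemma upward_contour_differentiable:
  assumes "upward_contour \<sigma> \<gamma>"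
  obtains S where "countable S" "\<And>t. t \<notin> S \<Longrightarrow> \<gamma> differentiable (at t)"
proof -
  have "\<exists>S. finite S \<and> (\<forall>t\<in>{-real n..real n} - S. \<gamma> differentiable (at t))" for n
    using assms
    by (fastforce simp: upward_contour_def piecewise_C1_differentiable_on_def C1_differentiable_on_eq)
  then obtain S where S: "\<And>n. finite (S n)" "\<And>n t. t \<in> {-real n..real n} - S n \<Longrightarrow> \<gamma> differentiable (at t)"
    by metis
  show ?thesis
  proof
    show "countable (\<Union>n. S n)"
      using S(1) by (intro countable_UN) (auto intro: countable_finite)
    fix t assume "t \<notin> (\<Union>n. S n)"
    moreover obtain n where "\<bar>t\<bar> \<le> real n"
      using real_arch_simple by blast
    ultimately show "\<gamma> differentiable (at t)"
      using S(2)[of t n] by (auto simp: abs_le_iff)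
  qed
qed

subsection \<open>The integrand of the I-function\<close>

text \<open>A point connected to another within the complement of the contour lies itself in that
  complement. This and its mirror image keep the numerator singularities off the contour.\<close>

lemma left_of_disjoint_range: "left_of \<gamma> \<inter> range \<gamma> = {}"
proof -
  have "w \<in> - range \<gamma>" if "w \<in> left_of \<gamma>" for w
    using that eventually_happens'[OF trivial_limit_at_bot_linorder] connected_component_in
    unfolding left_of_def by fastforce
  then show ?thesis
    by blast
qed

lemma right_of_disjoint_range: "right_of \<gamma> \<inter> range \<gamma> = {}"
proof -
  have "w \<in> - range \<gamma>" if "w \<in> right_of \<gamma>" for w
    using that eventually_happens'[OF trivial_limit_at_top_linorder] connected_component_in
    unfolding right_of_def by fastforce
  then show ?thesis
    by blast
qed

lemma sum_split_at:
  fixes f :: "nat \<Rightarrow> 'a::comm_monoid_add"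
  assumes "m \<le> q"
  shows "sum f {1..q} = sum f {1..m} + sum f {m+1..q}"
proof -
  have "{1..q} = {1..m} \<union> {m+1..q}"
    using assms by auto
  then show ?thesis
    by (simp add: sum.union_disjoint)
qed

text \<open>Here \<open>l\<close>, \<open>x\<close> and \<open>u\<close> stand for
  \<open>ln |t|\<close>, \<open>Re (\<gamma> t)\<close> and \<open>|t|\<close>. The logarithmic part
  sees the signed slopes \<open>\<kappa> j\<close>, the linear part their absolute values, whence
  the different sign patterns of \<open>\<mu>\<close> and \<open>\<Delta>\<close>.\<close>

lemma sum_growth_exponents:
  fixes c :: "nat \<Rightarrow> complex" and w \<kappa> :: "nat \<Rightarrow> real" and x l u :: real
  shows "(\<Sum>j\<in>J. w j * ((Re (c j) + \<kappa> j * x - 1/2) * l - pi / 2 * (\<bar>\<kappa> j\<bar> * u))) =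
    (\<Sum>j\<in>J. w j * (Re (c j) - 1/2)) * l + (\<Sum>j\<in>J. w j * \<kappa> j) * x * l
    - pi / 2 * (\<Sum>j\<in>J. w j * \<bar>\<kappa> j\<bar>) * u"
  unfolding sum_distrib_left sum_distrib_right sum.distrib[symmetric] sum_subtractf[symmetric]
  by (rule sum.cong) (simp_all add: algebra_simps)

text \<open>A numerator factor with slope \<open>- \<beta> j\<close> and an inverted denominator
  factor with slope \<open>\<beta> j\<close> both contribute
  \<open>B j * (Re (b j) - 1/2 - \<beta> j * Re (\<gamma> t))\<close> to the coefficient of
  \<open>ln |t|\<close>, so these sums run over all of \<open>{1..q}\<close>; similarly for the
  \<open>\<alpha> j\<close>. The terms in \<open>|t|\<close> change sign under inversion, which
  gives \<open>I_Delta\<close>.\<close>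

lemma log_growth_I_phi:
  fixes a b :: "nat \<Rightarrow> complex" and \<alpha> A \<beta> B :: "nat \<Rightarrow> real" and \<gamma> :: "real \<Rightarrow> complex"
  assumes mq: "m \<le> q" and np: "n \<le> p"
    and A: "\<And>j. j \<in> {1..p} \<Longrightarrow> \<alpha> j > 0 \<and> A j > 0"
    and B: "\<And>j. j \<in> {1..q} \<Longrightarrow> \<beta> j > 0 \<and> B j > 0"
    and \<gamma>: "\<forall>\<^sub>F t in at_infinity. Im (\<gamma> t) = t" "((\<lambda>t. Re (\<gamma> t)) \<longlongrightarrow> \<sigma>) at_infinity"
    and \<phi>: "I_phi_branch (range \<gamma>) m n p q a \<alpha> A b \<beta> B \<phi>"
  shows "log_growth (\<lambda>t. \<phi> (\<gamma> t))
    (\<lambda>t. - (I_nabla p q a A b B + I_mu p q \<alpha> A \<beta> B * Re (\<gamma> t)) * ln \<bar>t\<bar>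
         - pi / 2 * I_Delta m n p q \<alpha> A \<beta> B * \<bar>t\<bar>)"
proof -
  obtain G H where
    G1: "\<And>j. j \<in> {1..m} \<Longrightarrow> gamma_power_branch (range \<gamma>) (B j) (\<lambda>s. b j - \<beta> j * s) (G j)" and
    H1: "\<And>j. j \<in> {1..n} \<Longrightarrow> gamma_power_branch (range \<gamma>) (A j) (\<lambda>s. 1 - a j + \<alpha> j * s) (H j)" and
    G2: "\<And>j. j \<in> {m+1..q} \<Longrightarrow> gamma_power_branch (range \<gamma>) (B j) (\<lambda>s. 1 - b j + \<beta> j * s) (G j)" and
    H2: "\<And>j. j \<in> {n+1..p} \<Longrightarrow> gamma_power_branch (range \<gamma>) (A j) (\<lambda>s. a j - \<alpha> j * s) (H j)" and
    \<phi>_eq: "\<And>s. s \<in> range \<gamma> \<Longrightarrow> \<phi> s = ((\<Prod>j=1..m. G j s) * (\<Prod>j=1..n. H j s)) /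
                      ((\<Prod>j=m+1..q. G j s) * (\<Prod>j=n+1..p. H j s))"
    using \<phi> unfolding I_phi_branch_def by blast
  have pos: "\<And>j. j \<in> {1..m} \<Longrightarrow> \<beta> j > 0" "\<And>j. j \<in> {m+1..q} \<Longrightarrow> \<beta> j > 0"
    "\<And>j. j \<in> {1..n} \<Longrightarrow> \<alpha> j > 0" "\<And>j. j \<in> {n+1..p} \<Longrightarrow> \<alpha> j > 0"
    using A B mq np by simp_all
  have nz: "\<And>j. j \<in> {1..m} \<Longrightarrow> - \<beta> j \<noteq> 0" "\<And>j. j \<in> {m+1..q} \<Longrightarrow> \<beta> j \<noteq> 0"
    "\<And>j. j \<in> {1..n} \<Longrightarrow> \<alpha> j \<noteq> 0" "\<And>j. j \<in> {n+1..p} \<Longrightarrow> - \<alpha> j \<noteq> 0"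
    using pos by (simp_all add: less_imp_neq[symmetric])
  define E where "E w c \<kappa> t = w * ((Re c + \<kappa> * Re (\<gamma> t) - 1/2) * ln \<bar>t\<bar> - pi / 2 * (\<bar>\<kappa>\<bar> * \<bar>t\<bar>))"
    for w \<kappa> t :: real and c :: complex
  have G1': "log_growth (\<lambda>t. \<Prod>j=1..m. G j (\<gamma> t)) (\<lambda>t. \<Sum>j=1..m. E (B j) (b j) (- \<beta> j) t)"
    unfolding E_def
    by (intro log_growth_prod log_growth_gamma_power_branch[OF G1 _ nz(1) \<gamma>]) simp_all
  have H1': "log_growth (\<lambda>t. \<Prod>j=1..n. H j (\<gamma> t)) (\<lambda>t. \<Sum>j=1..n. E (A j) (1 - a j) (\<alpha> j) t)"
    unfolding E_def
    by (intro log_growth_prod log_growth_gamma_power_branch[OF H1 _ nz(3) \<gamma>]) simp_all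
  have G2': "log_growth (\<lambda>t. \<Prod>j=m+1..q. G j (\<gamma> t)) (\<lambda>t. \<Sum>j=m+1..q. E (B j) (1 - b j) (\<beta> j) t)"
    unfolding E_def
    by (intro log_growth_prod log_growth_gamma_power_branch[OF G2 _ nz(2) \<gamma>]) simp_all
  have H2': "log_growth (\<lambda>t. \<Prod>j=n+1..p. H j (\<gamma> t)) (\<lambda>t. \<Sum>j=n+1..p. E (A j) (a j) (- \<alpha> j) t)"
    unfolding E_def
    by (intro log_growth_prod log_growth_gamma_power_branch[OF H2 _ nz(4) \<gamma>]) simp_all
  have sums_B: "(\<Sum>j=1..m. B j * \<bar>- \<beta> j\<bar>) = (\<Sum>j=1..m. B j * \<beta> j)"
    "(\<Sum>j=m+1..q. B j * \<bar>\<beta> j\<bar>) = (\<Sum>j=m+1..q. B j * \<beta> j)"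
    by (intro sum.cong; simp add: pos abs_of_pos)+
  have sums_A: "(\<Sum>j=1..n. A j * \<bar>\<alpha> j\<bar>) = (\<Sum>j=1..n. A j * \<alpha> j)"
    "(\<Sum>j=n+1..p. A j * \<bar>- \<alpha> j\<bar>) = (\<Sum>j=n+1..p. A j * \<alpha> j)"
    by (intro sum.cong; simp add: pos abs_of_pos)+
  have neg: "(\<Sum>j\<in>J. w j * (Re (1 - c j) - 1/2)) = - (\<Sum>j\<in>J. w j * (Re (c j) - 1/2))"
    "(\<Sum>j\<in>J. w j * - \<kappa> j) = - (\<Sum>j\<in>J. w j * \<kappa> j)"
    for w \<kappa> :: "nat \<Rightarrow> real" and c :: "nat \<Rightarrow> complex" and J
    by (simp_all add: sum_negf[symmetric] algebra_simps)
  have "log_growth (\<lambda>t. ((\<Prod>j=1..m. G j (\<gamma> t)) * (\<Prod>j=1..n. H j (\<gamma> t))) *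
        inverse ((\<Prod>j=m+1..q. G j (\<gamma> t)) * (\<Prod>j=n+1..p. H j (\<gamma> t))))
      (\<lambda>t. ((\<Sum>j=1..m. E (B j) (b j) (- \<beta> j) t) + (\<Sum>j=1..n. E (A j) (1 - a j) (\<alpha> j) t)) +
        - ((\<Sum>j=m+1..q. E (B j) (1 - b j) (\<beta> j) t) + (\<Sum>j=n+1..p. E (A j) (a j) (- \<alpha> j) t)))"
    by (intro log_growth_mult log_growth_inverse G1' G2' H1' H2')
  also have "(\<lambda>t. ((\<Prod>j=1..m. G j (\<gamma> t)) * (\<Prod>j=1..n. H j (\<gamma> t))) *
        inverse ((\<Prod>j=m+1..q. G j (\<gamma> t)) * (\<Prod>j=n+1..p. H j (\<gamma> t)))) = (\<lambda>t. \<phi> (\<gamma> t))"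
    by (simp add: \<phi>_eq divide_inverse)
  also have "(\<lambda>t. ((\<Sum>j=1..m. E (B j) (b j) (- \<beta> j) t) + (\<Sum>j=1..n. E (A j) (1 - a j) (\<alpha> j) t)) +
        - ((\<Sum>j=m+1..q. E (B j) (1 - b j) (\<beta> j) t) + (\<Sum>j=n+1..p. E (A j) (a j) (- \<alpha> j) t))) =
    (\<lambda>t. - (I_nabla p q a A b B + I_mu p q \<alpha> A \<beta> B * Re (\<gamma> t)) * ln \<bar>t\<bar>
         - pi / 2 * I_Delta m n p q \<alpha> A \<beta> B * \<bar>t\<bar>)"
    unfolding E_def sum_growth_exponents I_nabla_def I_mu_def I_Delta_def sums_A sums_B neg
      sum_split_at[OF mq] sum_split_at[OF np]
    by (simp add: algebra_simps)
  finally show ?thesis .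
qed

text \<open>Numerator factors are continuous because the contour avoids their singularities.
  Denominator factors may meet poles on the contour, so continuity is taken from their
  reciprocals.\<close>

lemma continuous_I_phi:
  fixes a b :: "nat \<Rightarrow> complex" and \<alpha> A \<beta> B :: "nat \<Rightarrow> real" and \<gamma> :: "real \<Rightarrow> complex"
  assumes mq: "m \<le> q" and np: "n \<le> p"
    and A: "\<And>j. j \<in> {1..p} \<Longrightarrow> A j > 0"
    and B: "\<And>j. j \<in> {1..q} \<Longrightarrow> B j > 0"
    and \<gamma>: "continuous_on UNIV \<gamma>"
    and right: "\<And>j. j \<in> {1..m} \<Longrightarrow> gamma_singularities (\<lambda>s. b j - \<beta> j * s) \<inter> range \<gamma> = {}"
    and left: "\<And>j. j \<in> {1..n} \<Longrightarrow> gamma_singularities (\<lambda>s. 1 - a j + \<alpha> j * s) \<inter> range \<gamma> = {}"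
    and \<phi>: "I_phi_branch (range \<gamma>) m n p q a \<alpha> A b \<beta> B \<phi>"
  shows "continuous_on UNIV (\<lambda>t. \<phi> (\<gamma> t))"
proof -
  obtain G H where
    G1: "\<And>j. j \<in> {1..m} \<Longrightarrow> gamma_power_branch (range \<gamma>) (B j) (\<lambda>s. b j - \<beta> j * s) (G j)" and
    H1: "\<And>j. j \<in> {1..n} \<Longrightarrow> gamma_power_branch (range \<gamma>) (A j) (\<lambda>s. 1 - a j + \<alpha> j * s) (H j)" and
    G2: "\<And>j. j \<in> {m+1..q} \<Longrightarrow> gamma_power_branch (range \<gamma>) (B j) (\<lambda>s. 1 - b j + \<beta> j * s) (G j)" and
    H2: "\<And>j. j \<in> {n+1..p} \<Longrightarrow> gamma_power_branch (range \<gamma>) (A j) (\<lambda>s. a j - \<alpha> j * s) (H j)" and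
    \<phi>_eq: "\<And>s. s \<in> range \<gamma> \<Longrightarrow> \<phi> s = ((\<Prod>j=1..m. G j s) * (\<Prod>j=1..n. H j s)) /
                      ((\<Prod>j=m+1..q. G j s) * (\<Prod>j=n+1..p. H j s))"
    using \<phi> unfolding I_phi_branch_def by blast
  have "continuous_on UNIV (\<lambda>t. G j (\<gamma> t))" if "j \<in> {1..m}" for j
    using right[OF that] by (intro continuous_gamma_power_branch[OF G1[OF that] \<gamma>]) auto
  moreover have "continuous_on UNIV (\<lambda>t. H j (\<gamma> t))" if "j \<in> {1..n}" for j
    using left[OF that] by (intro continuous_gamma_power_branch[OF H1[OF that] \<gamma>]) auto
  moreover have "continuous_on UNIV (\<lambda>t. inverse (G j (\<gamma> t)))" if "j \<in> {m+1..q}" for j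
    using B[of j] that
    by (intro continuous_inverse_gamma_power_branch[OF G2[OF that] \<gamma>] continuous_intros) auto
  moreover have "continuous_on UNIV (\<lambda>t. inverse (H j (\<gamma> t)))" if "j \<in> {n+1..p}" for j
    using A[of j] that
    by (intro continuous_inverse_gamma_power_branch[OF H2[OF that] \<gamma>] continuous_intros) auto
  ultimately have "continuous_on UNIV (\<lambda>t. (\<Prod>j=1..m. G j (\<gamma> t)) * (\<Prod>j=1..n. H j (\<gamma> t)) *
      ((\<Prod>j=m+1..q. inverse (G j (\<gamma> t))) * (\<Prod>j=n+1..p. inverse (H j (\<gamma> t)))))"
    by (intro continuous_on_mult continuous_on_prod)
  then show ?thesis
    by (simp add: \<phi>_eq divide_inverse prod_inversef[symmetric] o_def)
qed

section \<open>Decay of the integrand along the contour\<close>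

lemma log_growth_power_arg:
  assumes "\<forall>\<^sub>F t in at_infinity. Im (\<gamma> t) = t" "((\<lambda>t. Re (\<gamma> t)) \<longlongrightarrow> \<sigma>) at_infinity"
  shows "log_growth (\<lambda>t. power_arg z \<theta> (\<gamma> t)) (\<lambda>t. - \<theta> * t)"
proof -
  \<comment> \<open>\<open>ln |z^s| = Re s * ln |z| - \<theta> * Im s\<close>, and the first term is
    bounded near the ends because it converges.\<close>
  have "((\<lambda>t. Re (\<gamma> t) * ln (cmod z)) \<longlongrightarrow> \<sigma> * ln (cmod z)) at_infinity"
    by (intro tendsto_intros assms)
  then have "(\<lambda>t. Re (\<gamma> t) * ln (cmod z)) \<in> O[at_infinity](\<lambda>_. 1)"
    by (intro bigoI_tendsto[where c = "\<sigma> * ln (cmod z)"]) auto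
  moreover have "\<forall>\<^sub>F t in at_infinity.
      ln (cmod (power_arg z \<theta> (\<gamma> t))) - - \<theta> * t = Re (\<gamma> t) * ln (cmod z)"
    using assms(1) by eventually_elim (simp add: power_arg_def)
  ultimately show ?thesis
    by (simp add: log_growth_def landau_o.big.in_cong) (simp add: power_arg_def)
qed

text \<open>The comparison is assumed for every \<open>C\<close> so that it absorbs the unknown
  constant behind the \<open>O(1)\<close>.\<close>

lemma log_growth_imp_powr_bound:
  assumes "log_growth f E" "\<And>C. \<forall>\<^sub>F t in at_infinity. E t + C \<le> e * ln \<bar>t\<bar>"
  shows "\<forall>\<^sub>F t in at_infinity. cmod (f t) \<le> \<bar>t\<bar> powr e"
proof -
  obtain C where C: "\<forall>\<^sub>F t in at_infinity. norm (ln (cmod (f t)) - E t) \<le> C * norm (1::real)"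
    using assms(1) unfolding log_growth_def by (auto elim: landau_o.bigE)
  have nz: "\<forall>\<^sub>F t in at_infinity. f t \<noteq> 0"
    using assms(1) by (simp add: log_growth_def)
  have "\<forall>\<^sub>F t :: real in at_infinity. \<bar>t\<bar> \<ge> 1"
    unfolding eventually_at_infinity real_norm_def by blast
  with C nz assms(2)[of C] show ?thesis
  proof eventually_elim
    case (elim t)
    then have "ln (cmod (f t)) \<le> e * ln \<bar>t\<bar>"
      by (auto simp: abs_le_iff)
    then have "exp (ln (cmod (f t))) \<le> exp (e * ln \<bar>t\<bar>)"
      by simp
    then show ?case
      using elim by (auto simp: powr_def)
  qed
qed

lemma ln_dominated_linear:
  fixes C D \<delta> :: real
  assumes "\<delta> > 0"
  shows "\<forall>\<^sub>F t :: real in at_infinity. D * ln \<bar>t\<bar> + C \<le> \<delta> * \<bar>t\<bar>"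
proof -
  have "((\<lambda>u. D * (ln u / u) + C * inverse u) \<longlongrightarrow> D * 0 + C * 0) at_top"
    by (intro tendsto_intros ln_x_over_x_tendsto_0 tendsto_inverse_0_at_top filterlim_ident)
  then have "\<forall>\<^sub>F u in at_top. D * (ln u / u) + C * inverse u < \<delta>"
    using assms by (intro order_tendstoD(2)) auto
  with eventually_gt_at_top[of 0] have "\<forall>\<^sub>F u in at_top. D * ln u + C \<le> \<delta> * u"
    by eventually_elim (simp add: field_simps)
  from eventually_compose_filterlim[OF this filterlim_norm_at_top[where 'a = real]] show ?thesis
    by simp
qed

lemma ln_abs_at_infinity:
  "\<forall>\<^sub>F t :: real in at_infinity. ln \<bar>t\<bar> \<ge> C"
  using eventually_compose_filterlim[OF eventually_ge_at_top
      filterlim_compose[OF ln_at_top filterlim_norm_at_top[where 'a = real]]] by simp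

theorem theorem1:
  fixes m n p q :: nat
    and a b :: "nat \<Rightarrow> complex"
    and \<alpha> A \<beta> B :: "nat \<Rightarrow> real"
    and \<gamma> :: "real \<Rightarrow> complex" and \<phi> :: "complex \<Rightarrow> complex"
    and z :: complex and \<sigma> \<theta> \<Delta> \<mu> \<nu> :: real
  assumes "m \<le> q" and "n \<le> p"
    and "\<And>j. j \<in> {1..p} \<Longrightarrow> \<alpha> j > 0 \<and> A j > 0"
    and "\<And>j. j \<in> {1..q} \<Longrightarrow> \<beta> j > 0 \<and> B j > 0"
    and "\<And>j k. j \<in> {1..m} \<Longrightarrow> k \<in> {1..n} \<Longrightarrow>
           gamma_singularities (\<lambda>s. b j - \<beta> j * s) \<inter>
           gamma_singularities (\<lambda>s. 1 - a k + \<alpha> k * s) = {}"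
    and "upward_contour \<sigma> \<gamma>"
    and "\<And>j. j \<in> {1..m} \<Longrightarrow> gamma_singularities (\<lambda>s. b j - \<beta> j * s) \<subseteq> right_of \<gamma>"
    and "\<And>j. j \<in> {1..n} \<Longrightarrow> gamma_singularities (\<lambda>s. 1 - a j + \<alpha> j * s) \<subseteq> left_of \<gamma>"
    and "I_phi_branch (range \<gamma>) m n p q a \<alpha> A b \<beta> B \<phi>"
    and "\<Delta> = I_Delta m n p q \<alpha> A \<beta> B"
    and "\<mu> = I_mu p q \<alpha> A \<beta> B"
    and "\<nu> = I_nabla p q a A b B"
    and "z \<noteq> 0" and "is_Arg z \<theta>"
  shows "(\<Delta> > 0 \<and> \<bar>\<theta>\<bar> < \<Delta> * pi / 2 \<longrightarrow>
            contour_integral_converges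
              (\<lambda>s. 1 / (2 * pi * \<i>) * (\<phi> s * power_arg z \<theta> s)) \<gamma>) \<and>
         (\<bar>\<theta>\<bar> = \<Delta> * pi / 2 \<and> \<Delta> \<ge> 0 \<and>
            (\<mu> = 0 \<and> \<nu> > 1 \<or> \<mu> \<noteq> 0 \<and> \<nu> + \<sigma> * \<mu> > 1) \<longrightarrow>
            contour_integral_converges_absolutely
              (\<lambda>s. 1 / (2 * pi * \<i>) * (\<phi> s * power_arg z \<theta> s)) \<gamma>)"
proof -
  obtain K where K: "K-lipschitz_on UNIV \<gamma>"
    using assms(6) by (auto simp: upward_contour_def)
  have \<gamma>: "\<forall>\<^sub>F t in at_infinity. Im (\<gamma> t) = t" "((\<lambda>t. Re (\<gamma> t)) \<longlongrightarrow> \<sigma>) at_infinity"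
    using assms(6) by (auto simp: upward_contour_def eventually_at_infinity)
  have cont_\<gamma>: "continuous_on UNIV \<gamma>"
    using K by (rule lipschitz_on_continuous_on)
  obtain S where S: "countable S" "\<And>t. t \<notin> S \<Longrightarrow> \<gamma> differentiable (at t)"
    using upward_contour_differentiable[OF assms(6)] by blast
  define f where "f = (\<lambda>s. 1 / (2 * pi * \<i>) * (\<phi> s * power_arg z \<theta> s))"
  define E where "E = (\<lambda>t. - (\<nu> + \<mu> * Re (\<gamma> t)) * ln \<bar>t\<bar> - pi / 2 * \<Delta> * \<bar>t\<bar> - \<theta> * t)"
  have "continuous_on UNIV (\<lambda>t. \<phi> (\<gamma> t))"
    by (rule continuous_I_phi[OF assms(1,2) _ _ cont_\<gamma> _ _ assms(9)])
       (use assms(3,4,7,8) left_of_disjoint_range right_of_disjoint_range in blast)+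
  then have cont_f: "continuous_on UNIV (\<lambda>t. f (\<gamma> t))"
    unfolding f_def power_arg_def by (intro continuous_intros cont_\<gamma>) auto
  have "log_growth (\<lambda>t. \<phi> (\<gamma> t)) (\<lambda>t. - (\<nu> + \<mu> * Re (\<gamma> t)) * ln \<bar>t\<bar> - pi / 2 * \<Delta> * \<bar>t\<bar>)"
    unfolding assms(10-12) by (rule log_growth_I_phi[OF assms(1-4) \<gamma> assms(9)])
  from log_growth_mult[OF log_growth_const log_growth_mult[OF this log_growth_power_arg[OF \<gamma>]],
      of "1 / (2 * pi * \<i>)" z \<theta>]
  have growth: "log_growth (\<lambda>t. f (\<gamma> t)) E"
    by (simp add: f_def E_def)
  \<comment> \<open>It remains to compare \<open>E\<close> with \<open>e * ln |t|\<close> for some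
    \<open>e < -1\<close>.\<close>
  have abs_conv: "contour_integral_converges_absolutely f \<gamma>"
    if "e < -1" "\<And>C. \<forall>\<^sub>F t in at_infinity. E t + C \<le> e * ln \<bar>t\<bar>" for e
    unfolding contour_integral_converges_absolutely_def
    by (rule absolutely_integrable_along_curve[OF K S cont_f that(1)
          log_growth_imp_powr_bound[OF growth that(2)]])
  have Re_lim: "((\<lambda>t. \<nu> + \<mu> * Re (\<gamma> t)) \<longlongrightarrow> \<nu> + \<mu> * \<sigma>) at_infinity"
    by (intro tendsto_intros \<gamma>)
  \<comment> \<open>Strictly inside the sector the decay is exponential, so any exponent below -1 is
    within reach; -2 is one choice.\<close>
  have inside: "contour_integral_converges_absolutely f \<gamma>" if "\<bar>\<theta>\<bar> < \<Delta> * pi / 2"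
  proof (rule abs_conv[of "-2"])
    fix C
    define M where "M = \<nu> + \<mu> * \<sigma> - 1"
    have "\<forall>\<^sub>F t in at_infinity. \<nu> + \<mu> * Re (\<gamma> t) > M"
      by (rule order_tendstoD(1)[OF Re_lim]) (simp add: M_def)
    moreover have "\<forall>\<^sub>F t in at_infinity. (2 - M) * ln \<bar>t\<bar> + C \<le> (\<Delta> * pi / 2 - \<bar>\<theta>\<bar>) * \<bar>t\<bar>"
      using that by (intro ln_dominated_linear) simp
    ultimately show "\<forall>\<^sub>F t in at_infinity. E t + C \<le> -2 * ln \<bar>t\<bar>"
      using ln_abs_at_infinity[of 0]
    proof eventually_elim
      case (elim t)
      have "M * ln \<bar>t\<bar> \<le> (\<nu> + \<mu> * Re (\<gamma> t)) * ln \<bar>t\<bar>"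
        using elim by (intro mult_right_mono) auto
      moreover have "- \<theta> * t \<le> \<bar>\<theta>\<bar> * \<bar>t\<bar>"
        by (metis abs_ge_minus_self abs_mult mult_minus_left)
      ultimately show ?case
        using elim(2) by (simp add: E_def algebra_simps)
    qed
  qed simp
  have boundary: "contour_integral_converges_absolutely f \<gamma>"
    if "\<bar>\<theta>\<bar> = \<Delta> * pi / 2" "\<nu> + \<mu> * \<sigma> > 1"
  proof -
    \<comment> \<open>A third of the margin above 1: one part covers the deviation of
      \<open>Re (\<gamma> t)\<close> from its limit, one absorbs \<open>C\<close>, and one keeps the
      exponent below -1.\<close>
    define r where "r = (\<nu> + \<mu> * \<sigma> - 1) / 3"
    have r: "r > 0" "\<nu> + \<mu> * \<sigma> = 1 + 3 * r"
      using that(2) by (auto simp: r_def field_simps)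
    show ?thesis
    proof (rule abs_conv[of "- (1 + r)"])
      fix C
      have "\<forall>\<^sub>F t in at_infinity. \<nu> + \<mu> * Re (\<gamma> t) > 1 + 2 * r"
        using r by (intro order_tendstoD(1)[OF Re_lim]) simp
      then show "\<forall>\<^sub>F t in at_infinity. E t + C \<le> - (1 + r) * ln \<bar>t\<bar>"
        using ln_abs_at_infinity[of 0] ln_abs_at_infinity[of "C / r"]
      proof eventually_elim
        case (elim t)
        have "(1 + 2 * r) * ln \<bar>t\<bar> \<le> (\<nu> + \<mu> * Re (\<gamma> t)) * ln \<bar>t\<bar>"
          using elim by (intro mult_right_mono) auto
        moreover have "C \<le> r * ln \<bar>t\<bar>"
          using elim(3) r(1) by (simp add: field_simps)
        \<comment> \<open>In the worst direction the linear terms cancel, and only a power of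
          \<open>|t|\<close> is left.\<close>
        moreover have "- \<theta> * t \<le> \<Delta> * pi / 2 * \<bar>t\<bar>"
          unfolding that(1)[symmetric] by (metis abs_ge_minus_self abs_mult mult_minus_left)
        ultimately show ?case
          by (simp add: E_def algebra_simps)
      qed
    qed (use r in simp)
  qed
  have "contour_integral_converges f \<gamma>" if "contour_integral_converges_absolutely f \<gamma>"
    using that set_lebesgue_integral_eq_integral(1)
    unfolding contour_integral_converges_def contour_integral_converges_absolutely_def by blast
  \<comment> \<open>Both boundary cases amount to \<open>\<nu> + \<mu> * \<sigma> > 1\<close>; for
    \<open>\<mu> = 0\<close> the product vanishes.\<close>
  then show ?thesis
    using inside boundary unfolding f_def[symmetric] by (auto simp: mult.commute)
qed

end
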